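(* Let $t\ge 2$ and let $a\ge d\ge 0$ be integers with $a\ge 1$. Then ${\rm forb}(m,t\cdot F_{a,0,0,d})$ is $\Theta(m^a)$ as $m\to\infty$.
   Context: A matrix is simple if it is a (0,1)-matrix with no repeated columns. For (0,1)-matrices $F$ and $A$, $F\prec A$ means some row and column permutation of $F$ is a submatrix of $A$. ${\rm forb}(m,F)$ is the maximum number of columns of an $m$-rowed simple matrix $A$ with $F\not\prec A$ ($F$ need not be simple). $t\cdot M$ denotes the concatenation of $t$ copies of the matrix $M$. $F_{e,f,g,h}$ denotes the $(e+f+g+h)\times 2$ (0,1)-matrix with $e$ rows $[1\,1]$, $f$ rows $[1\,0]$, $g$ rows $[0\,1]$ and $h$ rows $[0\,0]$. *)

theory Defs
  imports
    "Jordan_Normal_Form.DL_Submatrix"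
    "HOL-Combinatorics.Permutations"
    "HOL-Library.Landau_Symbols"
begin

definition zero_one_mat :: "nat mat \<Rightarrow> bool" where
  "zero_one_mat A \<longleftrightarrow> elements_mat A \<subseteq> {0, 1}"

definition simple_mat :: "nat mat \<Rightarrow> bool" where
  "simple_mat A \<longleftrightarrow> zero_one_mat A \<and> distinct (cols A)"

definition permute_mat :: "(nat \<Rightarrow> nat) \<Rightarrow> (nat \<Rightarrow> nat) \<Rightarrow> 'a mat \<Rightarrow> 'a mat" where
  "permute_mat p q F = mat (dim_row F) (dim_col F) (\<lambda>(i, j). F $$ (p i, q j))"

definition configuration_in :: "'a mat \<Rightarrow> 'a mat \<Rightarrow> bool" (infix "\<prec>\<^sub>c" 50) where
  "F \<prec>\<^sub>c A \<longleftrightarrow>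
     (\<exists>p q I J. p permutes {..<dim_row F} \<and> q permutes {..<dim_col F} \<and>
        permute_mat p q F = submatrix A I J)"

definition avoiding :: "nat \<Rightarrow> nat mat \<Rightarrow> nat mat set" where
  "avoiding m F = {A. dim_row A = m \<and> simple_mat A \<and> \<not> F \<prec>\<^sub>c A}"

definition forb :: "nat \<Rightarrow> nat mat \<Rightarrow> nat" where
  "forb m F = Max (dim_col ` avoiding m F)"

definition copies_mat :: "nat \<Rightarrow> 'a mat \<Rightarrow> 'a mat" where
  "copies_mat t M = mat_of_cols (dim_row M) (concat (replicate t (cols M)))"

definition F_mat :: "nat \<Rightarrow> nat \<Rightarrow> nat \<Rightarrow> nat \<Rightarrow> nat mat" where
  "F_mat e f g h = mat_of_rows_list 2
     (replicate e [1, 1] @ replicate f [1, 0] @ replicate g [0, 1] @ replicate h [0, 0])"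

text \<open>The maximum in \<^const>\<open>forb\<close> is attained: the set is finite, and nonempty as soon as
  the forbidden matrix has a column.\<close>

lemma finite_dim_col_avoiding: "finite (dim_col ` avoiding m F)"
proof -
  define V where "V = {v :: nat vec. dim_vec v = m \<and> (\<forall>i<m. v $ i \<in> {0, 1})}"
  have "V \<subseteq> vec_of_list ` {xs. set xs \<subseteq> {0, 1} \<and> length xs = m}"
  proof
    fix v assume v: "v \<in> V"
    have "set (list_of_vec v) \<subseteq> {0, 1}"
    proof
      fix x assume "x \<in> set (list_of_vec v)"
      then obtain i where i: "i < m" "x = list_of_vec v ! i"
        using v unfolding V_def by (auto simp: in_set_conv_nth)
      then have "x = v $ i"
        by (metis list_of_vec_index)
      moreover have "v $ i \<in> {0, 1}" using v i(1) unfolding V_def by simp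
      ultimately show "x \<in> {0, 1}" by simp
    qed
    moreover have "length (list_of_vec v) = m" using v unfolding V_def by simp
    ultimately show "v \<in> vec_of_list ` {xs. set xs \<subseteq> {0, 1} \<and> length xs = m}"
      by (intro image_eqI[where x = "list_of_vec v"]) (simp_all add: vec_list)
  qed
  then have fin: "finite V"
    by (rule finite_subset) (intro finite_imageI finite_lists_length_eq, simp)
  have "dim_col A \<le> card V" if "A \<in> avoiding m F" for A
  proof -
    have A: "dim_row A = m" "zero_one_mat A" "distinct (cols A)"
      using that unfolding avoiding_def simple_mat_def by auto
    have "set (cols A) \<subseteq> V"
    proof
      fix v assume "v \<in> set (cols A)"
      then obtain j where j: "j < dim_col A" "v = col A j"
        by (auto simp: cols_def)
      have "v $ i \<in> {0, 1}" if "i < m" for i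
      proof -
        have "A \<in> carrier_mat m (dim_col A)"
          by (rule carrier_matI[OF A(1) refl])
        then have "A $$ (i, j) \<in> elements_mat A"
          by (rule elements_matI[OF _ that j(1) refl])
        then have "A $$ (i, j) \<in> {0, 1}"
          by (rule subsetD[OF A(2)[unfolded zero_one_mat_def]])
        moreover have "v $ i = A $$ (i, j)"
          unfolding j(2) by (rule index_col) (use that A(1) j(1) in simp_all)
        ultimately show ?thesis by (simp only:)
      qed
      then show "v \<in> V" unfolding V_def using A(1) j(2) by simp
    qed
    then have "card (set (cols A)) \<le> card V" by (rule card_mono[OF fin])
    then show ?thesis using A by (simp add: distinct_card)
  qed
  then have "dim_col ` avoiding m F \<subseteq> {..card V}" by auto
  then show ?thesis by (rule finite_subset) simp
qed

lemma avoiding_nonempty: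
  assumes "dim_col F > 0"
  shows "avoiding m F \<noteq> {}"
proof -
  have "\<not> F \<prec>\<^sub>c 0\<^sub>m m 0"
  proof
    assume "F \<prec>\<^sub>c 0\<^sub>m m 0"
    then obtain p q I J where "permute_mat p q F = submatrix (0\<^sub>m m 0) I J"
      unfolding configuration_in_def by blast
    then have "dim_col (permute_mat p q F) = dim_col (submatrix (0\<^sub>m m 0 :: nat mat) I J)"
      by simp
    then show False using assms by (simp add: permute_mat_def dim_submatrix)
  qed
  moreover have "simple_mat (0\<^sub>m m 0)"
    by (auto simp: simple_mat_def zero_one_mat_def elements_mat_def cols_def)
  ultimately have "0\<^sub>m m 0 \<in> avoiding m F" unfolding avoiding_def by simp
  then show ?thesis by blast
qed

end

theory Submission
  imports Defs
begin

text \<open>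
  The matrix \<open>t \<cdot> F\<^bsub>a,0,0,d\<^esub>\<close> consists of \<open>2t\<close> copies of one column with \<open>a\<close> ones and \<open>d\<close> zeros.
  Read columns as subsets of the row set: a configuration is then a pair of disjoint sets
  \<open>R\<close>, \<open>S\<close> of sizes \<open>a\<close>, \<open>d\<close> and \<open>2t\<close> members of the family that contain \<open>R\<close> and avoid \<open>S\<close>.

  For the lower bound take all \<open>a\<close>-element sets. For the upper bound, strengthen the hypothesis to:
  all pairs of sizes \<open>(x, y)\<close> with \<open>x \<le> a\<close>, \<open>y \<le> d\<close>, \<open>x + y = d + e\<close> are forbidden; then the family
  has \<open>O(m\<^sup>e)\<close> members. Deleting a row \<open>v\<close> merges exactly the pairs \<open>B\<close>, \<open>B \<union> {v}\<close>; the sets \<open>B\<close>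
  that are doubled in this way satisfy the hypothesis for \<open>e - 1\<close>, because \<open>v\<close> can be appended both
  to \<open>R\<close> and to \<open>S\<close>. For \<open>e = 0\<close> the pigeonhole principle on any \<open>d\<close> rows bounds the family by a
  constant; here \<open>d \<le> a\<close> is needed, so that every pattern on \<open>d\<close> rows is forbidden.
  The theorem is the case \<open>e = a\<close>.
\<close>

section \<open>Patterns in set families under deletion of a row\<close>

definition has_pattern :: "'a set \<Rightarrow> nat \<Rightarrow> nat \<Rightarrow> nat \<Rightarrow> 'a set set \<Rightarrow> bool" where
  "has_pattern V s x y \<A> \<longleftrightarrow>
     (\<exists>R S \<B>. R \<subseteq> V \<and> S \<subseteq> V \<and> R \<inter> S = {} \<and> card R = x \<and> card S = y \<and>
        \<B> \<subseteq> \<A> \<and> card \<B> = s \<and> (\<forall>B\<in>\<B>. R \<subseteq> B \<and> S \<inter> B = {}))"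

lemma has_patternI:
  assumes "R \<subseteq> V" "S \<subseteq> V" "R \<inter> S = {}" "card R = x" "card S = y"
    "\<B> \<subseteq> \<A>" "card \<B> = s" "\<And>B. B \<in> \<B> \<Longrightarrow> R \<subseteq> B \<and> S \<inter> B = {}"
  shows "has_pattern V s x y \<A>"
  unfolding has_pattern_def
  by (rule exI[of _ R], rule exI[of _ S], rule exI[of _ \<B>]) (use assms in simp)

text \<open>One preimage under \<open>\<lambda>B. B - {v}\<close> is chosen for each trace, so the
  number of members is kept. As \<open>v\<close> lies in neither \<open>R\<close> nor
  \<open>S\<close>, restoring it disturbs neither condition.\<close>

lemma has_pattern_trace:
  assumes "v \<notin> V" and "has_pattern V s x y ((\<lambda>B. B - {v}) ` \<A>)"
  shows "has_pattern (insert v V) s x y \<A>"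
proof -
  obtain R S \<B> where *: "R \<subseteq> V" "S \<subseteq> V" "R \<inter> S = {}" "card R = x" "card S = y"
    "\<B> \<subseteq> (\<lambda>B. B - {v}) ` \<A>" "card \<B> = s" "\<forall>B\<in>\<B>. R \<subseteq> B \<and> S \<inter> B = {}"
    using assms(2) unfolding has_pattern_def by blast
  obtain \<C> where \<C>: "\<C> \<subseteq> \<A>" "inj_on (\<lambda>B. B - {v}) \<C>" "\<B> = (\<lambda>B. B - {v}) ` \<C>"
    using *(6) unfolding subset_image_inj by blast
  show ?thesis
  proof (rule has_patternI[of R _ S _ _ \<C>])
    show "card \<C> = s" using \<C> *(7) by (simp add: card_image)
    show "R \<subseteq> B \<and> S \<inter> B = {}" if "B \<in> \<C>" for B
    proof -
      have "R \<subseteq> B - {v}" "S \<inter> (B - {v}) = {}" using that \<C>(3) *(8) by auto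
      moreover have "v \<notin> S" using *(2) assms(1) by blast
      ultimately show ?thesis by blast
    qed
  qed (use * \<C> in auto)
qed

text \<open>Each doubled \<open>B\<close> offers two members: the sets \<open>insert v B\<close> let
  \<open>v\<close> join \<open>R\<close>, the sets \<open>B\<close> themselves let \<open>v\<close>
  join \<open>S\<close>. This is what lowers the exponent in the induction.\<close>

lemma has_pattern_doubled:
  assumes "v \<notin> V" "finite V"
    and "has_pattern V s x y {B. B \<subseteq> V \<and> B \<in> \<A> \<and> insert v B \<in> \<A>}"
  shows "has_pattern (insert v V) s (Suc x) y \<A>" and "has_pattern (insert v V) s x (Suc y) \<A>"
proof -
  obtain R S \<B> where *: "R \<subseteq> V" "S \<subseteq> V" "R \<inter> S = {}" "card R = x" "card S = y"
    "\<B> \<subseteq> {B. B \<subseteq> V \<and> B \<in> \<A> \<and> insert v B \<in> \<A>}" "card \<B> = s"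
    "\<forall>B\<in>\<B>. R \<subseteq> B \<and> S \<inter> B = {}"
    using assms(3) unfolding has_pattern_def by blast
  have v: "v \<notin> R" "v \<notin> S" "\<And>B. B \<in> \<B> \<Longrightarrow> v \<notin> B" using * assms(1) by auto
  have fin: "finite R" "finite S" using * assms(2) by (auto intro: finite_subset)
  show "has_pattern (insert v V) s (Suc x) y \<A>"
  proof (rule has_patternI[of "insert v R" _ S _ _ "insert v ` \<B>"])
    have "inj_on (insert v) \<B>" using v(3) by (auto simp: inj_on_def insert_ident)
    then show "card (insert v ` \<B>) = s" using * by (simp add: card_image)
  qed (use * v fin in auto)
  show "has_pattern (insert v V) s x (Suc y) \<A>"
    by (rule has_patternI[of R _ "insert v S" _ _ \<B>]) (use * v fin in auto)
qed

text \<open>Let \<open>X\<close> be the members without \<open>v\<close> and \<open>Y\<close> the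
  traces of those with \<open>v\<close>. Then card X + card Y = card (X \<union> Y) + card (X
  \<inter> Y), where the union is the whole trace and the intersection consists of the doubled
  sets.\<close>

lemma card_eq_trace_plus_doubled:
  assumes "finite V" "v \<notin> V" "\<A> \<subseteq> Pow (insert v V)"
  shows "card \<A> = card ((\<lambda>B. B - {v}) ` \<A>) + card {B. B \<subseteq> V \<and> B \<in> \<A> \<and> insert v B \<in> \<A>}"
proof -
  define X Y where "X = {B \<in> \<A>. v \<notin> B}" and "Y = (\<lambda>B. B - {v}) ` {B \<in> \<A>. v \<in> B}"
  have fin: "finite \<A>" using assms by (meson finite_Pow_iff finite_insert finite_subset)
  have "card \<A> = card (X \<union> {B \<in> \<A>. v \<in> B})" by (rule arg_cong[of _ _ card]) (auto simp: X_def)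
  also have "\<dots> = card X + card {B \<in> \<A>. v \<in> B}"
    by (rule card_Un_disjoint) (use fin in \<open>auto simp: X_def\<close>)
  also have "card {B \<in> \<A>. v \<in> B} = card Y"
    unfolding Y_def by (subst card_image) (auto simp: inj_on_def)
  also have "card X + card Y = card (X \<union> Y) + card (X \<inter> Y)"
    by (rule card_Un_Int) (use fin in \<open>auto simp: X_def Y_def\<close>)
  also have "X = (\<lambda>B. B - {v}) ` X" unfolding X_def by (auto simp: image_iff)
  then have "X \<union> Y = (\<lambda>B. B - {v}) ` (X \<union> {B \<in> \<A>. v \<in> B})"
    unfolding Y_def image_Un by simp
  also have "X \<union> {B \<in> \<A>. v \<in> B} = \<A>" unfolding X_def by blast
  also have "X \<inter> Y = {B. B \<subseteq> V \<and> B \<in> \<A> \<and> insert v B \<in> \<A>}"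
  proof (intro equalityI subsetI)
    fix B assume "B \<in> X \<inter> Y"
    then show "B \<in> {B. B \<subseteq> V \<and> B \<in> \<A> \<and> insert v B \<in> \<A>}"
      using assms(3) by (auto simp: X_def Y_def insert_absorb)
  next
    fix B assume B: "B \<in> {B. B \<subseteq> V \<and> B \<in> \<A> \<and> insert v B \<in> \<A>}"
    then have "v \<notin> B" "B = insert v B - {v}" using assms(2) by auto
    then show "B \<in> X \<inter> Y" using B unfolding X_def Y_def by blast
  qed
  finally show ?thesis .
qed

section \<open>Upper bound for set families\<close>

lemma card_le_if_no_pattern_on_rows:
  assumes "finite V" "\<A> \<subseteq> Pow V" "s \<ge> 1"
    and "\<And>x y. x + y = d \<Longrightarrow> \<not> has_pattern V s x y \<A>"
  shows "card \<A> \<le> 2 ^ d * s"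
\<comment> \<open>With fewer than \<open>d\<close> rows no \<open>d\<close>-set can be fixed, but
  then \<open>Pow V\<close> itself is small enough.\<close>
proof (cases "card V < d")
  case True
  have "card \<A> \<le> card (Pow V)" using assms by (intro card_mono) auto
  also have "\<dots> \<le> 2 ^ d" using True assms(1) by (simp add: card_Pow)
  also have "\<dots> \<le> 2 ^ d * s" using assms(3) by simp
  finally show ?thesis .
next
  case False
  then obtain D where D: "D \<subseteq> V" "card D = d" "finite D"
    by (metis not_less obtain_subset_with_card_n)
  have fin: "finite \<A>" using assms by (meson finite_Pow_iff finite_subset)
  \<comment> \<open>Members with the same intersection \<open>R\<close> with \<open>D\<close> all
    contain \<open>R\<close> and avoid \<open>D - R\<close>; more than \<open>s\<close> of them
    would contain a pattern with sizes summing to \<open>d\<close>.\<close>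
  have fibre: "card {B \<in> \<A>. B \<inter> D = R} \<le> s" if "R \<in> Pow D" for R
  proof (rule ccontr)
    assume "\<not> ?thesis"
    then obtain \<B> where \<B>: "\<B> \<subseteq> {B \<in> \<A>. B \<inter> D = R}" "card \<B> = s"
      using obtain_subset_with_card_n[of s "{B \<in> \<A>. B \<inter> D = R}"] by auto
    have "has_pattern V s (card R) (card (D - R)) \<A>"
      by (rule has_patternI[of R _ "D - R" _ _ \<B>]) (use \<B> D that in auto)
    moreover have "card R + card (D - R) = d"
      using that D by (metis PowD card_Diff_subset card_mono finite_subset le_add_diff_inverse)
    ultimately show False using assms(4) by blast
  qed
  have "card \<A> \<le> card (\<Union>R\<in>Pow D. {B \<in> \<A>. B \<inter> D = R})"
    using fin D by (intro card_mono) auto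
  also have "\<dots> \<le> (\<Sum>R\<in>Pow D. card {B \<in> \<A>. B \<inter> D = R})"
    using D by (intro card_UN_le) simp
  also have "\<dots> \<le> (\<Sum>R\<in>Pow D. s)" by (intro sum_mono fibre)
  also have "\<dots> = 2 ^ d * s" using D by (simp add: card_Pow)
  finally show ?thesis .
qed

text \<open>Outer induction on \<open>e\<close>, inner induction on \<open>V\<close>. Writing k =
  card V + 1 and C = 2^d * s, traces contribute at most C * k^(e+1) and doubled sets at most C *
  k^e; the sum is C * (k+1) * k^e, which is at most C * (k+1)^(e+1).\<close>

lemma card_le_if_no_pattern:
  assumes "finite V" "\<A> \<subseteq> Pow V" "s \<ge> 1" "d \<le> a" "e \<le> a"
    and "\<And>x y. x \<le> a \<Longrightarrow> y \<le> d \<Longrightarrow> x + y = d + e \<Longrightarrow> \<not> has_pattern V s x y \<A>"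
  shows "card \<A> \<le> 2 ^ d * s * (card V + 1) ^ e"
  using assms(1,2,5,6)
proof (induction e arbitrary: V \<A>)
  case 0
  have "card \<A> \<le> 2 ^ d * s"
    using 0 assms(3,4) by (intro card_le_if_no_pattern_on_rows[of V]) auto
  then show ?case by simp
next
  case (Suc e)
  show ?case using Suc.prems(1,2,4)
  proof (induction V arbitrary: \<A> rule: finite_induct)
    \<comment> \<open>The family may be \<open>{{}}\<close>, with one member; the \<open>+ 1\<close>
      in the base of the power keeps the bound positive here.\<close>
    case empty
    have "card \<A> \<le> card (Pow {} :: 'a set set)" using empty by (intro card_mono) auto
    also have "\<dots> \<le> 2 ^ d * s * (card ({} :: 'a set) + 1) ^ Suc e" using assms(3) by simp
    finally show ?case .
  next
    case (insert v V)
    define \<T> \<C> where "\<T> = (\<lambda>B. B - {v}) ` \<A>"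
      and "\<C> = {B. B \<subseteq> V \<and> B \<in> \<A> \<and> insert v B \<in> \<A>}"
    let ?k = "card V + 1"
    have \<T>: "card \<T> \<le> 2 ^ d * s * ?k ^ Suc e"
    proof (rule insert.IH)
      show "\<T> \<subseteq> Pow V" using insert.prems(1) by (auto simp: \<T>_def)
      show "\<not> has_pattern V s x y \<T>" if "x \<le> a" "y \<le> d" "x + y = d + Suc e" for x y
        using has_pattern_trace[OF insert.hyps(2)] insert.prems(2)[OF that] unfolding \<T>_def by blast
    qed
    have \<C>: "card \<C> \<le> 2 ^ d * s * ?k ^ e"
    proof (rule Suc.IH)
      show "\<not> has_pattern V s x y \<C>" if xy: "x \<le> a" "y \<le> d" "x + y = d + e" for x y
      proof
        assume pat: "has_pattern V s x y \<C>"
        note dbl = has_pattern_doubled[OF insert.hyps(2,1) pat[unfolded \<C>_def]]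
        \<comment> \<open>If x = a and y = d, then x + y = d + a, which exceeds d + e because
          \<open>Suc e \<le> a\<close>. So one of the two sizes can still grow by one.\<close>
        consider "x < a" | "y < d" using xy Suc.prems(3) by linarith
        then show False
        proof cases
          case 1
          then show False using insert.prems(2)[of "Suc x" y] xy dbl(1) by auto
        next
          case 2
          then show False using insert.prems(2)[of x "Suc y"] xy dbl(2) by auto
        qed
      qed
    qed (use insert.hyps Suc.prems in \<open>auto simp: \<C>_def\<close>)
    have "card \<A> = card \<T> + card \<C>"
      unfolding \<T>_def \<C>_def
      by (rule card_eq_trace_plus_doubled) (use insert.hyps insert.prems in auto)
    also have "\<dots> \<le> 2 ^ d * s * (?k ^ Suc e + ?k ^ e)"
      using \<T> \<C> by (simp add: distrib_left)
    also have "?k ^ Suc e + ?k ^ e = (?k + 1) * ?k ^ e" by (simp add: algebra_simps)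
    also have "\<dots> \<le> (?k + 1) * (?k + 1) ^ e" by (intro mult_left_mono power_mono) auto
    finally show ?case using insert.hyps by simp
  qed
qed

section \<open>Simple matrices as set families\<close>

lemma bij_betw_pick:
  "bij_betw (pick I) {..<card {i. i < n \<and> i \<in> I}} {i. i < n \<and> i \<in> I}"
proof -
  let ?J = "{i. i < n \<and> i \<in> I}"
  \<comment> \<open>\<open>I\<close> may be infinite or reach beyond \<open>n\<close>, whereas a
    submatrix sees only the indices below \<open>n\<close>; on the relevant range
    \<open>pick\<close> does not notice the difference.\<close>
  have eq: "pick I i = pick ?J i" if "i < card ?J" for i using pick_reduce_set[OF that] .
  have inj: "inj_on (pick I) {..<card ?J}"
    by (rule linorder_inj_onI) (auto simp: eq dest: pick_mono_le)
  have "pick I ` {..<card ?J} \<subseteq> ?J"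
    using eq pick_in_set_le[of _ ?J] by fastforce
  moreover have "card (pick I ` {..<card ?J}) = card ?J" using inj by (simp add: card_image)
  ultimately have "pick I ` {..<card ?J} = ?J" by (intro card_subset_eq) auto
  with inj show ?thesis by (simp add: bij_betw_def)
qed

definition col_support :: "nat mat \<Rightarrow> nat \<Rightarrow> nat set" where
  "col_support A j = {i. i < dim_row A \<and> A $$ (i, j) = 1}"

text \<open>A set of supports forgets the order and multiplicity of columns; for a simple matrix the
  number of columns survives, by \<open>card_supports\<close>.\<close>

definition supports :: "nat mat \<Rightarrow> nat set set" where
  "supports A = col_support A ` {..<dim_col A}"

lemma zero_one_mat_iff:
  "zero_one_mat A \<longleftrightarrow> (\<forall>i<dim_row A. \<forall>j<dim_col A. A $$ (i, j) = 0 \<or> A $$ (i, j) = 1)"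
proof -
  have "elements_mat A = {A $$ (i, j) |i j. i < dim_row A \<and> j < dim_col A}"
    unfolding elements_mat_def by fastforce
  then show ?thesis unfolding zero_one_mat_def by (auto simp: subset_iff)
qed

lemma inj_on_col_support:
  assumes "simple_mat A"
  shows "inj_on (col_support A) {..<dim_col A}"
proof (rule inj_onI)
  fix j k assume jk: "j \<in> {..<dim_col A}" "k \<in> {..<dim_col A}"
    and eq: "col_support A j = col_support A k"
  have "A $$ (i, j) = A $$ (i, k)" if "i < dim_row A" for i
  proof -
    have "A $$ (i, j) = 1 \<longleftrightarrow> A $$ (i, k) = 1"
      using eq that unfolding col_support_def by blast
    moreover have "A $$ (i, j) \<in> {0, 1}" "A $$ (i, k) \<in> {0, 1}"
      using assms that jk by (auto simp: simple_mat_def zero_one_mat_iff)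
    ultimately show ?thesis by auto
  qed
  then have "col A j = col A k" using jk by (intro eq_vecI) auto
  then have "cols A ! j = cols A ! k" using jk by simp
  then show "j = k" using assms jk unfolding simple_mat_def
    by (metis cols_length lessThan_iff nth_eq_iff_index_eq)
qed

lemma card_supports: "simple_mat A \<Longrightarrow> card (supports A) = dim_col A"
  unfolding supports_def by (simp add: card_image inj_on_col_support)

text \<open>Turns an extremal set family into a matrix, for the lower bound.\<close>

lemma ex_simple_mat_supports:
  assumes "\<A> \<subseteq> Pow {..<m}"
  obtains A where "dim_row A = m" "simple_mat A" "supports A = \<A>"
proof -
  have "finite \<A>" using assms by (meson finite_Pow_iff finite_lessThan finite_subset)
  then obtain Bs where Bs: "set Bs = \<A>" "distinct Bs"
    using finite_distinct_list by blast
  define A :: "nat mat" where "A = mat m (length Bs) (\<lambda>(i, j). if i \<in> Bs ! j then 1 else 0)"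
  have supp: "col_support A j = Bs ! j" if "j < length Bs" for j
  proof -
    have "Bs ! j \<subseteq> {..<m}" using that Bs assms nth_mem by blast
    then show ?thesis using that by (auto simp: A_def col_support_def split: if_splits)
  qed
  have supports: "supports A = \<A>"
    using supp Bs(1) by (auto simp: supports_def A_def set_conv_nth)
  have "distinct (cols A)"
    unfolding distinct_conv_nth
  proof (intro allI impI notI)
    fix j k assume jk: "j < length (cols A)" "k < length (cols A)" "j \<noteq> k"
      and "cols A ! j = cols A ! k"
    then have "col A j = col A k" by simp
    have "A $$ (i, j) = A $$ (i, k)" if "i < dim_row A" for i
      using arg_cong[OF \<open>col A j = col A k\<close>, of "\<lambda>v. v $ i"] jk that by simp
    then have "col_support A j = col_support A k" by (auto simp: col_support_def)
    then show False using supp jk Bs(2) by (simp add: A_def nth_eq_iff_index_eq)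
  qed
  moreover have "zero_one_mat A" by (simp add: zero_one_mat_iff A_def)
  ultimately show ?thesis using that[of A] supports by (simp add: simple_mat_def A_def)
qed

text \<open>Complements of equally large subsets are equally large, so a bijection from
  \<open>X\<close> to \<open>Y\<close> and one between the complements glue to a permutation. It
  serves to build the row permutation of a configuration.\<close>

lemma permutes_mapping_subset:
  assumes "finite U" "X \<subseteq> U" "Y \<subseteq> U" "card X = card Y"
  obtains p where "p permutes U" "\<And>i. i \<in> U \<Longrightarrow> p i \<in> Y \<longleftrightarrow> i \<in> X"
proof -
  have fin: "finite X" "finite Y" using assms finite_subset by auto
  obtain f where f: "bij_betw f X Y" using finite_same_card_bij[OF fin assms(4)] by blast
  have "card (U - X) = card (U - Y)" using assms fin by (simp add: card_Diff_subset)
  then obtain g where g: "bij_betw g (U - X) (U - Y)"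
    using finite_same_card_bij assms(1) by (metis finite_Diff)
  define p where "p i = (if i \<in> X then f i else if i \<in> U then g i else i)" for i
  have pf: "bij_betw p X Y" using f by (simp add: p_def cong: bij_betw_cong)
  have pg: "bij_betw p (U - X) (U - Y)" using g bij_betw_cong[of "U - X" p g] by (simp add: p_def)
  have "bij_betw p (X \<union> (U - X)) (Y \<union> (U - Y))" by (rule bij_betw_combine[OF pf pg]) auto
  then have "bij_betw p U U" using assms by (simp add: Un_absorb1)
  then have "p permutes U" by (rule bij_imp_permutes) (use assms(2) in \<open>auto simp: p_def\<close>)
  moreover have "p i \<in> Y \<longleftrightarrow> i \<in> X" if "i \<in> U" for i
    using pf pg that unfolding bij_betw_def by (metis Diff_iff image_eqI)
  ultimately show ?thesis using that by blast
qed

text \<open>All columns of \<open>F\<close> are equal, so column order is immaterial, and a row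
  permutation only decides which selected rows of \<open>A\<close> carry ones (\<open>R\<close>) and
  which carry zeros (\<open>S\<close>).\<close>

lemma configuration_in_iff_has_pattern:
  assumes A: "simple_mat A"
    and dim: "dim_row F = a + d" "dim_col F = s"
    and F: "\<And>i j. i < a + d \<Longrightarrow> j < s \<Longrightarrow> F $$ (i, j) = (if i < a then 1 else 0)"
  shows "F \<prec>\<^sub>c A \<longleftrightarrow> has_pattern {..<dim_row A} s a d (supports A)"
proof
  assume "F \<prec>\<^sub>c A"
  then obtain p q I J where pq: "p permutes {..<a + d}" "q permutes {..<s}"
    and eq: "permute_mat p q F = submatrix A I J"
    unfolding configuration_in_def dim by blast
  define I' J' where "I' = {i. i < dim_row A \<and> i \<in> I}" and "J' = {j. j < dim_col A \<and> j \<in> J}"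
  have card: "card I' = a + d" "card J' = s"
    using arg_cong[OF eq, of dim_row] arg_cong[OF eq, of dim_col]
    by (simp_all add: permute_mat_def dim dim_submatrix I'_def J'_def)
  have bI: "bij_betw (pick I) {..<a + d} I'" and bJ: "bij_betw (pick J) {..<s} J'"
    using bij_betw_pick[of I "dim_row A"] bij_betw_pick[of J "dim_col A"] card
    by (simp_all add: I'_def J'_def)
  have entry: "A $$ (pick I i, pick J j) = (if p i < a then 1 else 0)"
    if "i < a + d" "j < s" for i j
  proof -
    have "p i < a + d" "q j < s" using pq that permutes_in_image by (metis lessThan_iff)+
    then have "permute_mat p q F $$ (i, j) = (if p i < a then 1 else 0)"
      using that by (simp add: permute_mat_def dim F)
    then show ?thesis
      unfolding eq using that card by (simp add: submatrix_index I'_def J'_def)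
  qed
  \<comment> \<open>Positions in the submatrix whose rows are all ones, respectively all zeros.
    Their images under the permutation \<open>p\<close> are the first \<open>a\<close> and the last
    \<open>d\<close> indices, which gives their sizes.\<close>
  define X Y where "X = {i. i < a + d \<and> p i < a}" and "Y = {i. i < a + d \<and> \<not> p i < a}"
  have surj: "\<exists>i<a + d. p i = k" if "k < a + d" for k
    using permutes_image[OF pq(1)] that by (metis imageE lessThan_iff)
  have "p ` X = {..<a}"
  proof (intro equalityI subsetI)
    fix k assume "k \<in> {..<a}"
    then show "k \<in> p ` X" using surj[of k] by (auto simp: X_def)
  qed (auto simp: X_def)
  moreover have "p ` Y = {a..<a + d}"
  proof (intro equalityI subsetI)
    fix k assume "k \<in> {a..<a + d}"
    then show "k \<in> p ` Y" using surj[of k] by (auto simp: Y_def)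
  next
    fix k assume "k \<in> p ` Y"
    then obtain i where i: "i < a + d" "\<not> p i < a" "k = p i" by (auto simp: Y_def)
    moreover have "p i < a + d" using i(1) permutes_in_image[OF pq(1), of i] by simp
    ultimately show "k \<in> {a..<a + d}" by simp
  qed
  ultimately have cXY: "card X = a" "card Y = d"
    using card_image[of p X] card_image[of p Y] permutes_inj_on[OF pq(1)] by simp_all
  have XY: "X \<subseteq> {..<a + d}" "Y \<subseteq> {..<a + d}" "X \<inter> Y = {}" by (auto simp: X_def Y_def)
  have inj: "inj_on (pick I) {..<a + d}" using bI by (simp add: bij_betw_def)
  have sub: "pick I ` {..<a + d} \<subseteq> {..<dim_row A}" using bI by (auto simp: bij_betw_def I'_def)
  have J': "J' \<subseteq> {..<dim_col A}" by (auto simp: J'_def)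
  show "has_pattern {..<dim_row A} s a d (supports A)"
  proof (rule has_patternI[of "pick I ` X" _ "pick I ` Y" _ _ "col_support A ` J'"])
    show "pick I ` X \<subseteq> {..<dim_row A}" "pick I ` Y \<subseteq> {..<dim_row A}"
      using XY(1,2) sub by blast+
    show "pick I ` X \<inter> pick I ` Y = {}" using inj_on_image_Int[OF inj XY(1,2)] XY(3) by simp
    show "card (pick I ` X) = a" "card (pick I ` Y) = d"
      using cXY XY inj by (simp_all add: card_image inj_on_subset)
    show "card (col_support A ` J') = s"
      using card J' inj_on_col_support[OF A] by (simp add: card_image inj_on_subset)
    fix B assume "B \<in> col_support A ` J'"
    then obtain j where j: "j < s" "B = col_support A (pick J j)"
      using bJ by (auto simp: bij_betw_def)
    show "pick I ` X \<subseteq> B \<and> pick I ` Y \<inter> B = {}"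
      using entry[OF _ j(1)] sub by (auto simp: j(2) col_support_def X_def Y_def)
  qed (use J' in \<open>auto simp: supports_def\<close>)
next
  assume "has_pattern {..<dim_row A} s a d (supports A)"
  then obtain R S \<B> where *: "R \<subseteq> {..<dim_row A}" "S \<subseteq> {..<dim_row A}" "R \<inter> S = {}"
    "card R = a" "card S = d" "\<B> \<subseteq> col_support A ` {..<dim_col A}" "card \<B> = s"
    "\<forall>B\<in>\<B>. R \<subseteq> B \<and> S \<inter> B = {}"
    unfolding has_pattern_def supports_def by blast
  \<comment> \<open>One column index is chosen per member of \<open>\<B>\<close>, so exactly
    \<open>s\<close> columns are selected.\<close>
  obtain J where J: "J \<subseteq> {..<dim_col A}" "inj_on (col_support A) J" "\<B> = col_support A ` J"
    using *(6) unfolding subset_image_inj by blast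
  define I where "I = R \<union> S"
  have fin: "finite R" "finite S" using * by (auto intro: finite_subset)
  have sets: "{i. i < dim_row A \<and> i \<in> I} = I" "{j. j < dim_col A \<and> j \<in> J} = J"
    using * J by (auto simp: I_def)
  have card: "card I = a + d" "card J = s"
    using * J fin by (simp_all add: I_def card_Un_disjoint card_image)
  have bI: "bij_betw (pick I) {..<a + d} I" and bJ: "bij_betw (pick J) {..<s} J"
    using bij_betw_pick[of I "dim_row A"] bij_betw_pick[of J "dim_col A"]
    unfolding sets card .
  \<comment> \<open>Positions that rows of \<open>R\<close> take within the sorted set
    \<open>I\<close>; \<open>p\<close> must send exactly these to the one-rows of \<open>F\<close>,
    the indices below \<open>a\<close>.\<close>
  define X where "X = {i. i < a + d \<and> pick I i \<in> R}"
  have "pick I ` X = R" using bI by (force simp: bij_betw_def I_def X_def image_iff set_eq_iff)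
  moreover have "inj_on (pick I) X"
    using bI by (auto simp: bij_betw_def X_def inj_on_def)
  ultimately have "card X = card {..<a}" using *(4) card_image by fastforce
  then obtain p where p: "p permutes {..<a + d}" "\<And>i. i < a + d \<Longrightarrow> p i < a \<longleftrightarrow> i \<in> X"
    using permutes_mapping_subset[of "{..<a + d}" X "{..<a}"] by (auto simp: X_def)
  have "permute_mat p id F = submatrix A I J"
  proof (rule eq_matI)
    show "dim_row (permute_mat p id F) = dim_row (submatrix A I J)"
      "dim_col (permute_mat p id F) = dim_col (submatrix A I J)"
      by (simp_all add: permute_mat_def dim dim_submatrix sets card)
    fix i j assume "i < dim_row (submatrix A I J)" "j < dim_col (submatrix A I J)"
    then have ij: "i < a + d" "j < s" by (simp_all add: dim_submatrix sets card)
    have pi: "p i < a + d" using p(1) ij by (metis lessThan_iff permutes_in_image)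
    have lhs: "permute_mat p id F $$ (i, j) = (if pick I i \<in> R then 1 else 0)"
      using ij pi p(2)[OF ij(1)] by (simp add: permute_mat_def dim F X_def)
    have mem: "pick I i \<in> I" "pick J j \<in> J" using bI bJ ij by (auto simp: bij_betw_def)
    then have "R \<subseteq> col_support A (pick J j)" "S \<inter> col_support A (pick J j) = {}"
      using *(8) J(3) by auto
    moreover have "pick I i < dim_row A" "pick J j < dim_col A"
      using mem sets by blast+
    moreover from this have "A $$ (pick I i, pick J j) \<in> {0, 1}"
      using A by (auto simp: simple_mat_def zero_one_mat_iff)
    ultimately have "A $$ (pick I i, pick J j) = (if pick I i \<in> R then 1 else 0)"
      using mem(1) unfolding I_def col_support_def by auto
    then show "permute_mat p id F $$ (i, j) = submatrix A I J $$ (i, j)"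
      using lhs ij by (simp add: submatrix_index sets card)
  qed
  then show "F \<prec>\<^sub>c A"
    unfolding configuration_in_def dim using p(1) permutes_id by blast
qed

section \<open>The repeated two-column matrix\<close>

lemma dim_copies_F_mat:
  "dim_row (copies_mat t (F_mat a 0 0 d)) = a + d" "dim_col (copies_mat t (F_mat a 0 0 d)) = 2 * t"
  by (simp_all add: copies_mat_def F_mat_def mat_of_rows_list_def length_concat sum_list_replicate)

lemma index_copies_F_mat:
  assumes "i < a + d" "j < 2 * t"
  shows "copies_mat t (F_mat a 0 0 d) $$ (i, j) = (if i < a then 1 else 0)"
proof -
  let ?F = "F_mat a 0 0 d" and ?cs = "concat (replicate t (cols (F_mat a 0 0 d)))"
  have dim: "dim_row ?F = a + d" "dim_col ?F = 2" by (simp_all add: F_mat_def mat_of_rows_list_def)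
  have len: "length ?cs = 2 * t" using dim by (simp add: length_concat sum_list_replicate)
  \<comment> \<open>Which of the two columns sits at position \<open>j\<close> is left open: without
    rows [1 0] and [0 1] they coincide.\<close>
  have "?cs ! j \<in> set (cols ?F)" using nth_mem[of j ?cs] len assms(2) by auto
  then obtain k where k: "k < 2" "?cs ! j = col ?F k" by (auto simp: cols_def dim)
  have "copies_mat t ?F $$ (i, j) = ?F $$ (i, k)"
    using assms len k by (simp add: copies_mat_def mat_of_cols_index dim)
  also have "\<dots> = (if i < a then 1 else 0)"
    using assms(1) k(1) by (auto simp: F_mat_def mat_of_rows_list_def nth_append less_2_cases_iff)
  finally show ?thesis .
qed

lemma avoiding_copies_F_mat_iff:
  "A \<in> avoiding m (copies_mat t (F_mat a 0 0 d)) \<longleftrightarrow>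
     dim_row A = m \<and> simple_mat A \<and> \<not> has_pattern {..<m} (2 * t) a d (supports A)"
proof -
  have "copies_mat t (F_mat a 0 0 d) \<prec>\<^sub>c A \<longleftrightarrow>
      has_pattern {..<dim_row A} (2 * t) a d (supports A)" if "simple_mat A"
    using that dim_copies_F_mat index_copies_F_mat by (rule configuration_in_iff_has_pattern)
  then show ?thesis unfolding avoiding_def mem_Collect_eq by metis
qed

section \<open>Explicit bounds on \<open>forb\<close> and the asymptotics\<close>

lemma forb_copies_F_mat_le:
  assumes "t \<ge> 1" "d \<le> a"
  shows "forb m (copies_mat t (F_mat a 0 0 d)) \<le> 2 ^ d * (2 * t) * (m + 1) ^ a"
proof -
  let ?G = "copies_mat t (F_mat a 0 0 d)"
  have "dim_col A \<le> 2 ^ d * (2 * t) * (m + 1) ^ a" if "A \<in> avoiding m ?G" for A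
  proof -
    have A: "dim_row A = m" "simple_mat A" "\<not> has_pattern {..<m} (2 * t) a d (supports A)"
      using that by (simp_all add: avoiding_copies_F_mat_iff)
    have "card (supports A) \<le> 2 ^ d * (2 * t) * (card {..<m} + 1) ^ a"
    proof (rule card_le_if_no_pattern[where a = a])
      show "supports A \<subseteq> Pow {..<m}" using A(1) by (auto simp: supports_def col_support_def)
      \<comment> \<open>At e = a the bounds on \<open>x\<close> and \<open>y\<close> leave only the
        pair (a, d), the one pattern that is forbidden.\<close>
      fix x y assume "x \<le> a" "y \<le> d" "x + y = d + a"
      then have "x = a" "y = d" by linarith+
      then show "\<not> has_pattern {..<m} (2 * t) x y (supports A)" using A(3) by simp
    qed (use assms in auto)
    then show ?thesis using A(2) by (simp add: card_supports)
  qed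
  \<comment> \<open>Bounding every element bounds \<open>Max\<close> only for a nonempty
    set.\<close>
  moreover have "avoiding m ?G \<noteq> {}"
    by (rule avoiding_nonempty) (use assms in \<open>simp add: dim_copies_F_mat\<close>)
  ultimately show ?thesis
    unfolding forb_def using finite_dim_col_avoiding by (subst Max_le_iff) auto
qed

text \<open>In the family of all \<open>a\<close>-sets, only \<open>R\<close> itself contains a
  given \<open>a\<close>-set \<open>R\<close>, whatever \<open>S\<close> is; a pattern would require
  2t > 1 such members.\<close>

lemma binomial_le_forb_copies_F_mat:
  assumes "t \<ge> 1"
  shows "m choose a \<le> forb m (copies_mat t (F_mat a 0 0 d))"
proof -
  let ?\<A> = "{B. B \<subseteq> {..<m} \<and> card B = a}"
  have "?\<A> \<subseteq> Pow {..<m}" by blast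
  then obtain A where A: "dim_row A = m" "simple_mat A" "supports A = ?\<A>"
    by (rule ex_simple_mat_supports)
  have "\<not> has_pattern {..<m} (2 * t) a d ?\<A>"
  proof
    assume "has_pattern {..<m} (2 * t) a d ?\<A>"
    then obtain R S \<B> where *: "card R = a" "\<B> \<subseteq> ?\<A>" "card \<B> = 2 * t"
      "\<forall>B\<in>\<B>. R \<subseteq> B \<and> S \<inter> B = {}"
      unfolding has_pattern_def by (elim exE conjE)
    have "B = R" if "B \<in> \<B>" for B
    proof -
      have B: "B \<subseteq> {..<m}" "card B = a" "R \<subseteq> B" using that *(2,4) by blast+
      then have "R = B" using *(1) by (intro card_subset_eq) (auto intro: finite_subset)
      then show ?thesis ..
    qed
    then have "card \<B> \<le> card {R}" by (intro card_mono) auto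
    then show False using *(3) assms by simp
  qed
  then have "A \<in> avoiding m (copies_mat t (F_mat a 0 0 d))"
    using A by (simp add: avoiding_copies_F_mat_iff)
  then have "dim_col A \<le> forb m (copies_mat t (F_mat a 0 0 d))"
    unfolding forb_def using finite_dim_col_avoiding by (intro Max_ge) auto
  moreover have "dim_col A = m choose a"
    using card_supports[OF A(2)] A(3) n_subsets[of "{..<m}" a] by simp
  ultimately show ?thesis by simp
qed

theorem theorem4:
  fixes t a d :: nat
  assumes "t \<ge> 2" and "a \<ge> d" and "a \<ge> 1"
  shows "(\<lambda>m. real (forb m (copies_mat t (F_mat a 0 0 d)))) \<in> \<Theta>(\<lambda>m. real m ^ a)"
proof (rule bigthetaI)
  let ?f = "\<lambda>m. forb m (copies_mat t (F_mat a 0 0 d))"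
  \<comment> \<open>The factor 2^a absorbs the shift: m + 1 is at most 2m once m is at least
    1.\<close>
  let ?c = "2 ^ d * (2 * t) * 2 ^ a"
  show "(\<lambda>m. real (?f m)) \<in> O(\<lambda>m. real m ^ a)"
  proof (rule landau_o.bigI[of "real ?c"])
    show "eventually (\<lambda>m. norm (real (?f m)) \<le> real ?c * norm (real m ^ a)) at_top"
      using eventually_ge_at_top[of 1]
    proof eventually_elim
      case (elim m)
      have "?f m \<le> 2 ^ d * (2 * t) * (m + 1) ^ a"
        using assms by (intro forb_copies_F_mat_le) auto
      also have "\<dots> \<le> 2 ^ d * (2 * t) * (2 * m) ^ a"
        using elim by (intro mult_left_mono power_mono) auto
      also have "\<dots> = ?c * m ^ a" by (simp add: power_mult_distrib)
      finally have "real (?f m) \<le> real (?c * m ^ a)" by (simp only: of_nat_le_iff)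
      then show ?case by simp
    qed
  qed (use assms in simp)
  show "(\<lambda>m. real (?f m)) \<in> \<Omega>(\<lambda>m. real m ^ a)"
  \<comment> \<open>The constant comes from (m/a)^a \<le> \<open>m choose a\<close>, valid for m at
    least a.\<close>
  proof (rule landau_omega.bigI[of "1 / real a ^ a"])
    show "eventually (\<lambda>m. norm (real (?f m)) \<ge> 1 / real a ^ a * norm (real m ^ a)) at_top"
      using eventually_ge_at_top[of a]
    proof eventually_elim
      case (elim m)
      have "(real m / real a) ^ a \<le> real (m choose a)"
        by (rule binomial_ge_n_over_k_pow_k[OF elim])
      also have "\<dots> \<le> real (?f m)"
        using assms by (intro of_nat_mono binomial_le_forb_copies_F_mat) simp
      finally show ?case by (simp add: power_divide)
    qed
  qed (use assms in simp)
qed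

end
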